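(* Let $[c,d]$ be a finite closed interval, let $m$ and $n$ be positive integers, let $\Delta_j$, $j=1,\ldots,n$, be partitions of $[c,d]$, and let $\Delta=\bigcup_{j=1}^n\Delta_j$. For each $j$ let $\#\Delta_j$ denote the number of interior knots of $\Delta_j$, and let $\{B^{(j)}_{m,k} : k=1,\ldots,m+\#\Delta_j\}$ be the B-spline basis for $S_m(\Delta_j)$ (associated with a fixed extended partition of $\Delta_j$). Define $$\mathcal{D}_m\Big(\Delta:\bigcup_{j=1}^n\Delta_j\Big):=\bigcup_{j=1}^n\{B^{(j)}_{m,k} : k=1,\ldots,m+\#\Delta_j\}.$$ Then $$\operatorname{span}\Big\{\mathcal{D}_m\Big(\Delta:\bigcup_{j=1}^n\Delta_j\Big)\Big\}=S_m(\Delta).$$ When $n=1$, $\mathcal{D}_m(\Delta:\Delta_1)$ reduces to the B-spline basis of $S_m(\Delta)$.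
   Context: A partition of a finite closed interval $[c,d]$ ($c<d$) is a finite set of points $\Delta=\{x_i\}_{i=0}^{N+1}$, $N\in\mathbb{N}=\{1,2,\dots\}$, such that $c=x_0<x_1<\cdots<x_N<x_{N+1}=d$. The points $x_1,\dots,x_N$ are its interior knots, so $\#\Delta=N$ in the convention used here. Its associated subintervals are $I_i=[x_i,x_{i+1})$ for $i=0,\dots,N-1$ and $I_N=[x_N,x_{N+1}]$. A finite union of partitions of $[c,d]$ (as sets of points) is again a partition of $[c,d]$. For $k\in\mathbb{N}\cup\{0\}$, $\Pi_k$ denotes the space of (real) polynomials of degree at most $k$. For a positive integer $m$, the spline space of order $m$ is $$S_m(\Delta)=\{f\in C^{m-2}[c,d] : f|_{I_i}\in\Pi_{m-1},\ i=0,\dots,N\},$$ where $f|_{I_i}$ is the restriction of $f$ to $I_i$. For $m=1$ the condition $f\in C^{-1}[c,d]$ is void, i.e. $f$ is any real function on $[c,d]$ whose restriction to each $I_i$ is constant. An extended partition with single inner knots associated with $S_m(\Delta)$ is a family $\tilde{\Delta}=\{y_i\}_{i=1}^{2m+N}$ such that $y_{m+i}=x_i$ for $i=1,\ldots,N$, and the first and last $m$ points, satisfying $y_1\le\cdots\le y_m\le c$ and $d\le y_{m+N+1}\le\cdots\le y_{2m+N}$, are chosen arbitrarily. With each fixed extended partition $\tilde{\Delta}$ there is associated a unique B-spline basis $\{B_{m,j}\}_{j=1}^{m+N}$ for $S_m(\Delta)$ (it is a standard fact that this is a basis of $S_m(\Delta)$), consisting of the restrictions to $[c,d]$ of the functions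 defined recursively by $$B_{1,j}(x)=\begin{cases}1,& y_j\le x<y_{j+1},\\ 0,&\text{otherwise,}\end{cases}$$ and, for $r\geq 2$, $$B_{r,j}(x)=\frac{x-y_j}{y_{j+r-1}-y_j}B_{r-1,j}(x)+\frac{y_{j+r}-x}{y_{j+r}-y_{j+1}}B_{r-1,j+1}(x),$$ with the usual conventions that a term with vanishing denominator is taken to be $0$ and that the value at the right endpoint $x=d$ is the limit from the left. *)

theory Defs
  imports "HOL-Analysis.Analysis" "HOL-Library.Function_Algebras"
    "HOL-Computational_Algebra.Polynomial"
begin

text \<open>Pointwise scaling, which makes the library notions \<^term>\<open>span\<close> and
  \<^term>\<open>independent\<close> available for real functions.\<close>

instantiation "fun" :: (type, real_vector) real_vector
begin

definition scaleR_fun :: "real \<Rightarrow> ('a \<Rightarrow> 'b) \<Rightarrow> 'a \<Rightarrow> 'b" where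
  "scaleR_fun a f = (\<lambda>x. a *\<^sub>R f x)"

instance
  by standard
    (simp_all add: scaleR_fun_def plus_fun_def fun_eq_iff scaleR_add_right scaleR_add_left)

end

definition interior_knots :: "real \<Rightarrow> real \<Rightarrow> real set \<Rightarrow> real set" where
  "interior_knots c d \<Delta> = \<Delta> - {c, d}"

definition num_knots :: "real \<Rightarrow> real \<Rightarrow> real set \<Rightarrow> nat" where
  "num_knots c d \<Delta> = card (interior_knots c d \<Delta>)"

text \<open>A partition is identified with its set of points, and at least one interior knot is
  required.\<close>

definition is_partition :: "real \<Rightarrow> real \<Rightarrow> real set \<Rightarrow> bool" where
  "is_partition c d \<Delta> \<longleftrightarrow>
     finite \<Delta> \<and> \<Delta> \<subseteq> {c..d} \<and> c \<in> \<Delta> \<and> d \<in> \<Delta> \<and> num_knots c d \<Delta> \<ge> 1"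

text \<open>The point \<open>x\<^sub>i\<close>, counted from \<open>x\<^sub>0 = c\<close>.\<close>

definition knot :: "real set \<Rightarrow> nat \<Rightarrow> real" where
  "knot \<Delta> i = sorted_list_of_set \<Delta> ! i"

definition subinterval :: "real \<Rightarrow> real \<Rightarrow> real set \<Rightarrow> nat \<Rightarrow> real set" where
  "subinterval c d \<Delta> i =
     (if i < num_knots c d \<Delta> then {knot \<Delta> i ..< knot \<Delta> (Suc i)}
      else {knot \<Delta> i .. knot \<Delta> (Suc i)})"

text \<open>\<open>F i\<close> is the \<open>i\<close>-th derivative, one-sided at the end points.\<close>

definition Ck_on :: "nat \<Rightarrow> real \<Rightarrow> real \<Rightarrow> (real \<Rightarrow> real) \<Rightarrow> bool" where
  "Ck_on k c d f \<longleftrightarrow>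
     (\<exists>F. F 0 = f \<and>
        (\<forall>i<k. \<forall>x\<in>{c..d}. (F i has_real_derivative F (Suc i) x) (at x within {c..d})) \<and>
        continuous_on {c..d} (F k))"

text \<open>A function on \<open>[c, d]\<close> is represented by its extension by zero to all of \<open>\<real>\<close>; this makes
  the representation unique and compatible with the linear structure. For \<open>m = 1\<close> there is no
  smoothness condition.\<close>

definition spline_space :: "nat \<Rightarrow> real \<Rightarrow> real \<Rightarrow> real set \<Rightarrow> (real \<Rightarrow> real) set" where
  "spline_space m c d \<Delta> =
     {f. (\<forall>x. x \<notin> {c..d} \<longrightarrow> f x = 0) \<and>
         (m \<ge> 2 \<longrightarrow> Ck_on (m - 2) c d f) \<and>
         (\<forall>i\<le>num_knots c d \<Delta>. \<exists>p :: real poly. degree p \<le> m - 1 \<and>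
             (\<forall>x\<in>subinterval c d \<Delta> i. f x = poly p x))}"

text \<open>Only the values \<open>y 1, \<dots>, y (2 * m + N)\<close> matter.\<close>

definition extended_partition ::
    "nat \<Rightarrow> real \<Rightarrow> real \<Rightarrow> real set \<Rightarrow> (nat \<Rightarrow> real) \<Rightarrow> bool" where
  "extended_partition m c d \<Delta> y \<longleftrightarrow>
     (let N = num_knots c d \<Delta> in
        (\<forall>i\<in>{1..N}. y (m + i) = knot \<Delta> i) \<and>
        (\<forall>i\<in>{1..<m}. y i \<le> y (Suc i)) \<and> y m \<le> c \<and>
        d \<le> y (m + N + 1) \<and> (\<forall>i\<in>{m + N + 1..<2 * m + N}. y i \<le> y (Suc i)))"

text \<open>The order \<open>0\<close> is a dummy. Terms with a vanishing denominator are \<open>0\<close> because division by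
  zero yields zero.\<close>

fun bspline :: "(nat \<Rightarrow> real) \<Rightarrow> nat \<Rightarrow> nat \<Rightarrow> real \<Rightarrow> real" where
  "bspline y 0 j x = 0"
| "bspline y (Suc 0) j x = (if y j \<le> x \<and> x < y (j + 1) then 1 else 0)"
| "bspline y (Suc (Suc r)) j x =
     (x - y j) / (y (j + Suc r) - y j) * bspline y (Suc r) j x +
     (y (j + Suc (Suc r)) - x) / (y (j + Suc (Suc r)) - y (j + 1)) * bspline y (Suc r) (j + 1) x"

definition bspline_on ::
    "real \<Rightarrow> real \<Rightarrow> (nat \<Rightarrow> real) \<Rightarrow> nat \<Rightarrow> nat \<Rightarrow> real \<Rightarrow> real" where
  "bspline_on c d y m j x =
     (if c \<le> x \<and> x < d then bspline y m j x
      else if x = d then Lim (at_left d) (bspline y m j)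
      else 0)"

definition bspline_set ::
    "nat \<Rightarrow> real \<Rightarrow> real \<Rightarrow> real set \<Rightarrow> (nat \<Rightarrow> real) \<Rightarrow> (real \<Rightarrow> real) set" where
  "bspline_set m c d \<Delta> y = {bspline_on c d y m k |k. k \<in> {1..m + num_knots c d \<Delta>}}"

text \<open>Here \<open>P j\<close> is the \<open>j\<close>-th partition and \<open>Y j\<close> its extended partition.\<close>

definition spline_dictionary ::
    "nat \<Rightarrow> real \<Rightarrow> real \<Rightarrow> nat \<Rightarrow> (nat \<Rightarrow> real set) \<Rightarrow> (nat \<Rightarrow> nat \<Rightarrow> real) \<Rightarrow> (real \<Rightarrow> real) set" where
  "spline_dictionary m c d n P Y = (\<Union>j\<in>{1..n}. bspline_set m c d (P j) (Y j))"

end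

theory Submission
  imports Defs
begin

text \<open>Let \<open>T\<close> consist of the powers \<open>(x - c)\<^sup>k\<close>, \<open>k < m\<close>, and of the truncations of
  \<open>(x - x\<^sub>i) ^ (m - 1)\<close> to \<open>x \<ge> x\<^sub>i\<close> at the interior knots. It is independent, and it spans
  the spline space because the polynomial pieces on either side of \<open>x\<^sub>i\<close> differ by a multiple
  of \<open>(x - x\<^sub>i) ^ (m - 1)\<close>. Marsden's identity writes each of the \<open>m + N\<close> elements of
  \<open>T\<close> as a combination of the \<open>m + N\<close> B-splines. By counting, the B-splines are independent
  and span the same space as \<open>T\<close>, so their smoothness never has to be checked. Finally, the set
  \<open>T\<close> of a union of partitions is the union of the sets \<open>T\<close> of the partitions.\<close>

section \<open>Independence of truncated powers\<close>

text \<open>The pair holds the starting point and the exponent. Cutting off beyond \<open>d\<close>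
  matches the zero extension in \<open>spline_space\<close>; starting at \<open>c\<close> gives the
  plain powers on \<open>[c, d]\<close>, and exponent 0 gives a step, since
  \<open>0 ^ 0 = 1\<close>.\<close>

definition tpow :: "real \<Rightarrow> real \<times> nat \<Rightarrow> real \<Rightarrow> real" where
  "tpow d p x = (if fst p \<le> x \<and> x \<le> d then (x - fst p) ^ snd p else 0)"

lemma sum_fun_apply: "(\<Sum>i\<in>A. f i) x = (\<Sum>i\<in>A. f i x)"
  for f :: "'i \<Rightarrow> 'a \<Rightarrow> 'b::comm_monoid_add"
  by (induction A rule: infinite_finite_induct) auto

text \<open>These functions are little-o of \<open>(x - a) ^ k\<close> to the right of
  \<open>a\<close>; being a subspace, they contain the span of any such functions.\<close>

lemma subspace_vanishing:
  "subspace {f :: real \<Rightarrow> real. ((\<lambda>x. f x / (x - a) ^ k) \<longlongrightarrow> 0) (at_right a)}"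
proof (rule subspaceI; clarsimp simp: scaleR_fun_def)
  fix f g :: "real \<Rightarrow> real"
  assume "((\<lambda>x. f x / (x - a) ^ k) \<longlongrightarrow> 0) (at_right a)" "((\<lambda>x. g x / (x - a) ^ k) \<longlongrightarrow> 0) (at_right a)"
  then show "((\<lambda>x. (f x + g x) / (x - a) ^ k) \<longlongrightarrow> 0) (at_right a)"
    using tendsto_add by (fastforce simp: add_divide_distrib)
next
  fix c and f :: "real \<Rightarrow> real"
  assume "((\<lambda>x. f x / (x - a) ^ k) \<longlongrightarrow> 0) (at_right a)"
  from tendsto_mult_left[OF this, of c]
  show "((\<lambda>x. c * f x / (x - a) ^ k) \<longlongrightarrow> 0) (at_right a)" by simp
qed

lemma tpow_eventually_at_right:
  assumes "a < d"
  shows "eventually (\<lambda>x. a < x \<and> tpow d (a, k) x = (x - a) ^ k) (at_right a)"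
  unfolding eventually_at_right_field using assms
  by (intro exI[of _ d]) (auto simp: tpow_def)

text \<open>Division by \<open>(x - a) ^ k\<close> separates orders at \<open>a\<close>: generators
  that start later vanish just right of \<open>a\<close>, those with a higher exponent tend to 0,
  but \<open>tpow d (a, k)\<close> has quotient 1.\<close>

lemma tpow_not_in_span:
  assumes "a < d" and later: "\<And>b l. (b, l) \<in> S \<Longrightarrow> a < b \<or> a = b \<and> k < l"
  shows "tpow d (a, k) \<notin> span (tpow d ` S)"
proof
  assume "tpow d (a, k) \<in> span (tpow d ` S)"
  moreover have "span (tpow d ` S) \<subseteq> {f. ((\<lambda>x. f x / (x - a) ^ k) \<longlongrightarrow> 0) (at_right a)}"
  proof (rule span_minimal[OF _ subspace_vanishing], safe)
    fix b l assume "(b, l) \<in> S"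
    from later[OF this] consider "a < b" | "a = b" "k < l" by blast
    then show "((\<lambda>x. tpow d (b, l) x / (x - a) ^ k) \<longlongrightarrow> 0) (at_right a)"
    proof cases
      case 1
      have "eventually (\<lambda>x. tpow d (b, l) x / (x - a) ^ k = 0) (at_right a)"
        unfolding eventually_at_right_field using 1 by (intro exI[of _ b]) (auto simp: tpow_def)
      then show ?thesis by (rule tendsto_eventually)
    next
      case 2
      have "eventually (\<lambda>x. (x - a) ^ (l - k) = tpow d (b, l) x / (x - a) ^ k) (at_right a)"
        using tpow_eventually_at_right[OF assms(1), of l]
        by eventually_elim (use 2 in \<open>simp add: power_diff\<close>)
      moreover have "((\<lambda>x. (x - a) ^ (l - k)) \<longlongrightarrow> (a - a) ^ (l - k)) (at_right a)"
        by (intro tendsto_intros)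
      ultimately have "((\<lambda>x. tpow d (b, l) x / (x - a) ^ k) \<longlongrightarrow> (a - a) ^ (l - k)) (at_right a)"
        by (rule Lim_transform_eventually[rotated])
      then show ?thesis using 2 by (simp add: power_0_left)
    qed
  qed
  ultimately have "((\<lambda>x. tpow d (a, k) x / (x - a) ^ k) \<longlongrightarrow> 0) (at_right a)" by blast
  moreover have "eventually (\<lambda>x. tpow d (a, k) x / (x - a) ^ k = 1) (at_right a)"
    using tpow_eventually_at_right[OF assms(1), of k] by eventually_elim simp
  then have "((\<lambda>x. tpow d (a, k) x / (x - a) ^ k) \<longlongrightarrow> 1) (at_right a)"
    by (rule tendsto_eventually)
  ultimately show False
    using tendsto_unique[OF trivial_limit_at_right_real] by fastforce
qed

text \<open>Induction removes the lexicographically least index, by starting point and then by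
  exponent, so that \<open>tpow_not_in_span\<close> applies. Injectivity comes along because an
  element outside a span differs from its generators.\<close>

lemma independent_tpow:
  assumes "finite S" "\<And>a k. (a, k) \<in> S \<Longrightarrow> a < d"
  shows "independent (tpow d ` S) \<and> inj_on (tpow d) S"
  using assms
proof (induction S rule: finite_psubset_induct)
  case (psubset S)
  show ?case
  proof (cases "S = {}")
    case True
    then show ?thesis by (simp add: independent_empty)
  next
    case False
    define a where "a = Min (fst ` S)"
    define K where "K = {k. (a, k) \<in> S}"
    have "a \<in> fst ` S" unfolding a_def using False psubset.hyps by simp
    then have "K \<noteq> {}" by (auto simp: K_def)
    moreover have "finite K"
      by (rule finite_subset[OF _ finite_imageI[OF psubset.hyps, of snd]]) (force simp: K_def)
    ultimately have kK: "Min K \<in> K" "\<And>l. l \<in> K \<Longrightarrow> Min K \<le> l" by simp_all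
    define T where "T = S - {(a, Min K)}"
    have in_S: "(a, Min K) \<in> S" using kK by (simp add: K_def)
    then have IH: "independent (tpow d ` T)" "inj_on (tpow d) T"
      using psubset by (auto simp: T_def)
    have "a < b \<or> a = b \<and> Min K < l" if "(b, l) \<in> T" for b l
    proof -
      have "b \<in> fst ` S" using that by (force simp: T_def)
      then have "a \<le> b" using psubset.hyps by (simp add: a_def)
      moreover have "Min K < l" if "a = b"
        using \<open>(b, l) \<in> T\<close> that kK(2)[of l] by (auto simp: T_def K_def order.strict_iff_order)
      ultimately show ?thesis by fastforce
    qed
    then have new: "tpow d (a, Min K) \<notin> span (tpow d ` T)"
      using psubset.prems in_S by (intro tpow_not_in_span) auto
    have "S = insert (a, Min K) T" using in_S by (auto simp: T_def)
    moreover have "tpow d (a, Min K) \<notin> tpow d ` T" using new by (meson span_base)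
    ultimately show ?thesis using IH new by (auto simp: independent_insert)
  qed
qed

section \<open>Differentiability classes\<close>

lemma Ck_on_0: "Ck_on 0 c d f \<longleftrightarrow> continuous_on {c..d} f"
  unfolding Ck_on_def by (auto intro: exI[of _ "\<lambda>_. f"])

lemma Ck_on_Suc:
  assumes "Ck_on k c d g" "\<And>x. x \<in> {c..d} \<Longrightarrow> (f has_real_derivative g x) (at x within {c..d})"
  shows "Ck_on (Suc k) c d f"
proof -
  from assms(1) obtain G where "G 0 = g"
    "\<forall>i<k. \<forall>x\<in>{c..d}. (G i has_real_derivative G (Suc i) x) (at x within {c..d})"
    "continuous_on {c..d} (G k)"
    unfolding Ck_on_def by blast
  then show ?thesis unfolding Ck_on_def
    by (intro exI[of _ "\<lambda>i. case i of 0 \<Rightarrow> f | Suc i \<Rightarrow> G i"]) (auto split: nat.split simp: assms(2))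
qed

lemma Ck_on_lincomb:
  assumes "Ck_on k c d f" "Ck_on k c d g"
  shows "Ck_on k c d (\<lambda>x. r * f x + s * g x)"
proof -
  from assms(1) obtain F where "F 0 = f"
    "\<forall>i<k. \<forall>x\<in>{c..d}. (F i has_real_derivative F (Suc i) x) (at x within {c..d})"
    "continuous_on {c..d} (F k)"
    unfolding Ck_on_def by blast
  moreover from assms(2) obtain G where "G 0 = g"
    "\<forall>i<k. \<forall>x\<in>{c..d}. (G i has_real_derivative G (Suc i) x) (at x within {c..d})"
    "continuous_on {c..d} (G k)"
    unfolding Ck_on_def by blast
  ultimately show ?thesis unfolding Ck_on_def
    by (intro exI[of _ "\<lambda>i x. r * F i x + s * G i x"])
      (auto intro!: continuous_intros derivative_eq_intros)
qed

text \<open>The derivative sequence must start with a function given on all reals, although only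
  \<open>[c, d]\<close> matters; replacing its first member is enough. This copes with the cut-off
  of \<open>tpow\<close> at \<open>d\<close>.\<close>

lemma Ck_on_cong:
  assumes "Ck_on k c d f" "\<And>x. x \<in> {c..d} \<Longrightarrow> f x = g x"
  shows "Ck_on k c d g"
proof -
  from assms(1) obtain F where F: "F 0 = f"
    "\<forall>i<k. \<forall>x\<in>{c..d}. (F i has_real_derivative F (Suc i) x) (at x within {c..d})"
    "continuous_on {c..d} (F k)"
    unfolding Ck_on_def by blast
  define G where "G = F(0 := g)"
  have G: "F i x = G i x" if "x \<in> {c..d}" for i x using assms(2) that F(1) by (auto simp: G_def)
  have "(G i has_real_derivative G (Suc i) x) (at x within {c..d})" if "i < k" "x \<in> {c..d}" for i x
  proof -
    have "(F i has_real_derivative G (Suc i) x) (at x within {c..d})"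
      using F(2) that by (simp add: G_def)
    from has_field_derivative_transform_within[OF this zero_less_one that(2)]
    show ?thesis using G by blast
  qed
  moreover have "continuous_on {c..d} (G k)" using F(3) G by (metis continuous_on_cong)
  ultimately show ?thesis unfolding Ck_on_def by (intro exI[of _ G]) (simp add: G_def)
qed

lemma Ck_on_poly: "Ck_on k c d (poly p)"
proof (induction k arbitrary: p)
  case 0
  show ?case by (simp add: Ck_on_0 continuous_on_poly)
next
  case (Suc k)
  then show ?case
    by (rule Ck_on_Suc) (rule has_field_derivative_at_within[OF poly_DERIV])
qed

text \<open>The exponent is at least 2, so both one-sided derivatives vanish at \<open>a\<close> and
  the two formulas fit together.\<close>

lemma has_derivative_truncated_power:
  "((\<lambda>x. if a \<le> x then (x - a) ^ Suc (Suc e) else 0) has_real_derivative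
     real (Suc (Suc e)) * (if a \<le> x then (x - a) ^ Suc e else 0)) (at x)"
proof -
  consider "x < a" | "x = a" | "a < x" by linarith
  then show ?thesis
  proof cases
    case 1
    have "((\<lambda>x. 0) has_real_derivative 0) (at x)" by simp
    from has_field_derivative_transform_within_open[OF this open_lessThan, of a]
    show ?thesis using 1 by auto
  next
    case 2
    \<comment> \<open>At \<open>x = a\<close> the difference quotient is itself a truncated power of
      \<open>h\<close>, with the exponent lowered by one.\<close>
    have "((\<lambda>h. if 0 \<le> h then h ^ Suc e else 0 :: real) \<longlongrightarrow> 0) (at 0)"
    proof (rule Lim_null_comparison)
      show "eventually (\<lambda>h::real. norm (if 0 \<le> h then h ^ Suc e else 0) \<le> \<bar>h\<bar> ^ Suc e) (at 0)"
          by (intro always_eventually) (simp add: power_abs del: power_Suc)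
      have "((\<lambda>h::real. \<bar>h\<bar> ^ Suc e) \<longlongrightarrow> \<bar>0\<bar> ^ Suc e) (at 0)" by (intro tendsto_intros)
      then show "((\<lambda>h::real. \<bar>h\<bar> ^ Suc e) \<longlongrightarrow> 0) (at 0)" by simp
    qed
    moreover have "eventually (\<lambda>h::real. (if 0 \<le> h then h ^ Suc e else 0) =
        ((if a \<le> x + h then (x + h - a) ^ Suc (Suc e) else 0) - (if a \<le> x then (x - a) ^ Suc (Suc e) else 0)) / h) (at 0)"
      using 2 by (auto simp: eventually_at_filter)
    ultimately have "((\<lambda>h. ((if a \<le> x + h then (x + h - a) ^ Suc (Suc e) else 0) -
        (if a \<le> x then (x - a) ^ Suc (Suc e) else 0)) / h) \<longlongrightarrow> 0) (at 0)"
      by (rule Lim_transform_eventually)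
    then show ?thesis unfolding DERIV_def using 2 by simp
  next
    case 3
    have "((\<lambda>x. (x - a) ^ Suc (Suc e)) has_real_derivative real (Suc (Suc e)) * (x - a) ^ Suc e) (at x)"
      by (rule derivative_eq_intros refl)+ (simp del: power_Suc)
    from has_field_derivative_transform_within_open[OF this open_greaterThan, of a]
    show ?thesis using 3 by auto
  qed
qed

text \<open>The continuous function \<open>max 0 (x - a)\<close> starts the induction; raising the
  exponent gives an antiderivative up to a constant factor.\<close>

lemma Ck_on_truncated_power: "Ck_on k c d (\<lambda>x. if a \<le> x then (x - a) ^ Suc k else 0)"
proof (induction k)
  case 0
  have "(\<lambda>x. if a \<le> x then (x - a) ^ Suc 0 else 0) = (\<lambda>x. max 0 (x - a))" by auto
  then show ?case by (simp add: Ck_on_0) (intro continuous_intros)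
next
  case (Suc k)
  from Ck_on_lincomb[OF this this, of "real (Suc (Suc k))" 0]
  show ?case
    by (rule Ck_on_Suc)
      (simp del: power_Suc of_nat_Suc add: has_field_derivative_at_within has_derivative_truncated_power)
qed

section \<open>Truncated powers span the spline space\<close>

lemma partition_knots:
  assumes "c < d" "is_partition c d \<Delta>"
  shows knot_0: "knot \<Delta> 0 = c"
    and knot_last: "knot \<Delta> (Suc (num_knots c d \<Delta>)) = d"
    and knot_less: "\<And>i j. i < j \<Longrightarrow> j \<le> Suc (num_knots c d \<Delta>) \<Longrightarrow> knot \<Delta> i < knot \<Delta> j"
    and interior_knots_eq: "interior_knots c d \<Delta> = knot \<Delta> ` {1..num_knots c d \<Delta>}"
proof -
  have fin: "finite \<Delta>" and sub: "\<Delta> \<subseteq> {c..d}" and "c \<in> \<Delta>" "d \<in> \<Delta>"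
    using assms(2) by (auto simp: is_partition_def)
  have sorted: "sorted_wrt (<) (sorted_list_of_set \<Delta>)" by simp
  \<comment> \<open>This makes the subtraction of cardinalities exact: the sorted list has two more
    entries than there are interior knots.\<close>
  have "card {c, d} \<le> card \<Delta>" using fin \<open>c \<in> \<Delta>\<close> \<open>d \<in> \<Delta>\<close> by (intro card_mono) auto
  then have "card \<Delta> = card (interior_knots c d \<Delta>) + card {c, d}"
    using \<open>c \<in> \<Delta>\<close> \<open>d \<in> \<Delta>\<close> unfolding interior_knots_def
    by (subst card_Diff_subset) auto
  with assms(1) have len: "length (sorted_list_of_set \<Delta>) = num_knots c d \<Delta> + 2"
    by (simp add: num_knots_def)
  define N where "N = num_knots c d \<Delta>"
  show less: "knot \<Delta> i < knot \<Delta> j" if "i < j" "j \<le> Suc (num_knots c d \<Delta>)" for i j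
    unfolding knot_def using that len by (intro sorted_wrt_nth_less[OF sorted]) auto
  have \<Delta>: "\<Delta> = knot \<Delta> ` {..Suc N}"
  proof -
    have "\<Delta> = set (sorted_list_of_set \<Delta>)" using fin by simp
    also have "\<dots> = knot \<Delta> ` {..Suc N}"
      unfolding set_conv_nth len knot_def N_def by (auto simp: less_Suc_eq_le)
    finally show ?thesis .
  qed
  obtain i where i: "c = knot \<Delta> i" "i \<le> Suc N" using \<open>c \<in> \<Delta>\<close> \<Delta> by auto
  have "knot \<Delta> 0 \<in> {c..d}" using \<Delta> sub by blast
  then show k0: "knot \<Delta> 0 = c" using i less[of 0 i] by (cases "i = 0") (simp_all add: N_def)
  obtain j where j: "d = knot \<Delta> j" "j \<le> Suc N" using \<open>d \<in> \<Delta>\<close> \<Delta> by auto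
  have "knot \<Delta> (Suc N) \<in> {c..d}" using \<Delta> sub by blast
  then show kN: "knot \<Delta> (Suc (num_knots c d \<Delta>)) = d"
    using j(1)[symmetric] j(2) less[of j "Suc N"] unfolding N_def[symmetric]
    by (cases "j = Suc N") simp_all
  have "{..Suc N} = insert 0 (insert (Suc N) {1..N})" by auto
  then have "\<Delta> = insert c (insert d (knot \<Delta> ` {1..N}))"
    using \<Delta> k0 kN by (simp only: image_insert N_def[symmetric])
  moreover have "c < knot \<Delta> i \<and> knot \<Delta> i < d" if "i \<in> {1..N}" for i
    using less[of 0 i] less[of i "Suc N"] that k0 kN by (simp add: N_def)
  ultimately show "interior_knots c d \<Delta> = knot \<Delta> ` {1..num_knots c d \<Delta>}"
    unfolding interior_knots_def N_def by blast
qed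

lemma knots_between:
  assumes "c < d" "is_partition c d \<Delta>" "i \<le> Suc (num_knots c d \<Delta>)"
  shows "knot \<Delta> i \<in> {c..d}"
proof -
  have "c \<le> knot \<Delta> i" using knot_less[OF assms(1,2), of 0 i] knot_0[OF assms(1,2)] assms(3)
    by (cases "i = 0") auto
  moreover have "knot \<Delta> i \<le> d"
    using knot_less[OF assms(1,2), of i "Suc (num_knots c d \<Delta>)"] knot_last[OF assms(1,2)] assms(3)
    by (cases "i = Suc (num_knots c d \<Delta>)") auto
  ultimately show ?thesis by simp
qed

text \<open>By induction on \<open>k\<close>, the first \<open>k\<close> half-open pieces tile the
  interval from \<open>c\<close> up to knot \<open>k\<close>; the closed last piece supplies
  \<open>d\<close>.\<close>

lemma Icc_eq_subintervals:
  assumes "c < d" "is_partition c d \<Delta>"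
  shows "{c..d} = (\<Union>i\<le>num_knots c d \<Delta>. subinterval c d \<Delta> i)" (is "_ = (\<Union>i\<le>?N. _)")
proof -
  have "{c..<knot \<Delta> k} = (\<Union>i<k. subinterval c d \<Delta> i)" if "k \<le> ?N" for k
    using that
  proof (induction k)
    case 0
    then show ?case by (simp add: knot_0[OF assms])
  next
    case (Suc k)
    have "{c..<knot \<Delta> (Suc k)} = {c..<knot \<Delta> k} \<union> subinterval c d \<Delta> k"
      using knots_between[OF assms, of k] knot_less[OF assms, of k "Suc k"] Suc.prems
      by (auto simp: subinterval_def)
    then show ?case using Suc by (auto simp: lessThan_Suc)
  qed
  from this[of ?N] have "{c..<knot \<Delta> ?N} \<union> subinterval c d \<Delta> ?N = (\<Union>i\<le>?N. subinterval c d \<Delta> i)"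
    by (auto simp: lessThan_Suc_atMost[symmetric] lessThan_Suc)
  moreover have "{c..<knot \<Delta> ?N} \<union> subinterval c d \<Delta> ?N = {c..d}"
    using knots_between[OF assms, of ?N] knot_last[OF assms] by (auto simp: subinterval_def)
  ultimately show ?thesis by simp
qed

text \<open>The two parts are disjoint, as \<open>c\<close> is not an interior knot, which gives
  \<open>m + N\<close> indices for \<open>N\<close> interior knots. The definition also commutes
  with nonempty unions of partitions.\<close>

definition tpow_index :: "nat \<Rightarrow> real \<Rightarrow> real \<Rightarrow> real set \<Rightarrow> (real \<times> nat) set" where
  "tpow_index m c d \<Delta> = {c} \<times> {..<m} \<union> interior_knots c d \<Delta> \<times> {m - 1}"

text \<open>No subinterval is split by the starting point: the function is a power on the pieces to
  its right and zero on those to its left. On \<open>[c, d]\<close> it is a polynomial if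
  \<open>a = c\<close>, and otherwise a truncated power of exponent \<open>m - 1\<close>.\<close>

lemma tpow_in_spline_space:
  assumes "c < d" "is_partition c d \<Delta>" "m \<ge> 1" "p \<in> tpow_index m c d \<Delta>"
  shows "tpow d p \<in> spline_space m c d \<Delta>"
proof -
  obtain a k where p: "p = (a, k)" by force
  have "a \<in> {c..d}"
    using assms(1,2,4) p by (auto simp: tpow_index_def interior_knots_def is_partition_def)
  have "k \<le> m - 1" using assms(4) p by (auto simp: tpow_index_def)
  have smooth: "Ck_on (m - 2) c d (tpow d p)" if "m \<ge> 2"
  proof (cases "a = c")
    case True
    show ?thesis
      by (rule Ck_on_cong[OF Ck_on_poly[of _ _ _ "[:-a, 1:] ^ k"]]) (use True p in \<open>auto simp: tpow_def\<close>)
  next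
    case False
    then have "k = Suc (m - 2)" using assms(4) p that by (auto simp: tpow_index_def)
    then show ?thesis
      by (intro Ck_on_cong[OF Ck_on_truncated_power[of _ _ _ a]]) (use p in \<open>auto simp: tpow_def\<close>)
  qed
  have piece: "\<exists>q :: real poly. degree q \<le> m - 1 \<and> (\<forall>x\<in>subinterval c d \<Delta> i. tpow d p x = poly q x)"
    if i: "i \<le> num_knots c d \<Delta>" for i
  proof (cases "a \<le> knot \<Delta> i")
    case True
    have "subinterval c d \<Delta> i \<subseteq> {a..d}"
      using True knots_between[OF assms(1,2), of "Suc i"] i by (auto simp: subinterval_def split: if_splits)
    then have "tpow d p x = poly ([:-a, 1:] ^ k) x" if "x \<in> subinterval c d \<Delta> i" for x
      using that p by (auto simp: tpow_def)
    moreover have "degree ([:-a, 1:] ^ k) \<le> m - 1" using \<open>k \<le> m - 1\<close> by (simp add: degree_linear_power)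
    ultimately show ?thesis by blast
  next
    case False
    then obtain j where j: "a = knot \<Delta> j" "j \<le> num_knots c d \<Delta>" "1 \<le> j"
      using assms(4) p knot_0[OF assms(1,2)] knots_between[OF assms(1,2), of i] i
      by (auto simp: tpow_index_def interior_knots_eq[OF assms(1,2)])
    then have "i < j"
      using False knot_less[OF assms(1,2), of j i] i by (cases i j rule: linorder_cases) auto
    \<comment> \<open>Since \<open>i\<close> is not the last index, the piece is half-open and
      excludes \<open>a\<close>, where a power with exponent 0 would already be 1.\<close>
    then have "knot \<Delta> (Suc i) \<le> a" "i < num_knots c d \<Delta>"
      using j knot_less[OF assms(1,2), of "Suc i" j] by (cases "Suc i = j"; simp)+
    then have "\<forall>x\<in>subinterval c d \<Delta> i. tpow d p x = poly 0 x"
      using p by (auto simp: tpow_def subinterval_def)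
    then show ?thesis by (metis degree_0 le0)
  qed
  show ?thesis
    using smooth piece \<open>a \<in> {c..d}\<close> p by (auto simp: spline_space_def) (auto simp: tpow_def)
qed

lemma subspace_spline_space: "subspace (spline_space m c d \<Delta>)"
proof (rule subspaceI)
  have "Ck_on (m - 2) c d 0"
    using Ck_on_poly[of "m - 2" c d 0] by (simp add: zero_fun_def poly_0[abs_def])
  then show "0 \<in> spline_space m c d \<Delta>"
    unfolding spline_space_def by (auto intro: exI[of _ 0])
next
  fix f g assume "f \<in> spline_space m c d \<Delta>" "g \<in> spline_space m c d \<Delta>"
  note fg = this[unfolded spline_space_def mem_Collect_eq]
  have "\<exists>p. degree p \<le> m - 1 \<and> (\<forall>x\<in>subinterval c d \<Delta> i. (f + g) x = poly p x)"
    if "i \<le> num_knots c d \<Delta>" for i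
  proof -
    from fg that obtain p q where "degree p \<le> m - 1" "degree q \<le> m - 1"
      "\<forall>x\<in>subinterval c d \<Delta> i. f x = poly p x" "\<forall>x\<in>subinterval c d \<Delta> i. g x = poly q x" by meson
    then show ?thesis by (intro exI[of _ "p + q"]) (auto intro: degree_add_le)
  qed
  moreover have "Ck_on (m - 2) c d (f + g)" if "m \<ge> 2"
    using Ck_on_lincomb[of "m - 2" c d f g 1 1] fg that by (simp add: plus_fun_def)
  ultimately show "f + g \<in> spline_space m c d \<Delta>" using fg by (auto simp: spline_space_def)
next
  fix r f assume "f \<in> spline_space m c d \<Delta>"
  note f = this[unfolded spline_space_def mem_Collect_eq]
  have "\<exists>p. degree p \<le> m - 1 \<and> (\<forall>x\<in>subinterval c d \<Delta> i. (r *\<^sub>R f) x = poly p x)"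
    if "i \<le> num_knots c d \<Delta>" for i
  proof -
    from f that obtain p where "degree p \<le> m - 1" "\<forall>x\<in>subinterval c d \<Delta> i. f x = poly p x" by meson
    then show ?thesis by (intro exI[of _ "smult r p"]) (auto simp: scaleR_fun_def intro: order_trans[OF degree_smult_le])
  qed
  moreover have "Ck_on (m - 2) c d (r *\<^sub>R f)" if "m \<ge> 2"
    using Ck_on_lincomb[of "m - 2" c d f f r 0] f that by (simp add: scaleR_fun_def)
  ultimately show "r *\<^sub>R f \<in> spline_space m c d \<Delta>" using f by (auto simp: spline_space_def scaleR_fun_def)
qed

text \<open>Since \<open>a\<close> is a root of \<open>p\<close>, its order in a nonconstant
  \<open>p\<close> is one more than in \<open>pderiv p\<close>, to which the induction hypothesis
  applies.\<close>

lemma power_dvd_if_higher_pderiv_zero: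
  fixes p :: "real poly"
  assumes "\<And>l. l < k \<Longrightarrow> poly ((pderiv ^^ l) p) a = 0"
  shows "[:-a, 1:] ^ k dvd p"
  using assms
proof (induction k arbitrary: p)
  case (Suc k)
  have "poly ((pderiv ^^ l) (pderiv p)) a = 0" if "l < k" for l
    using Suc.prems[of "Suc l"] that by (simp add: funpow_swap1)
  then have IH: "[:-a, 1:] ^ k dvd pderiv p" by (rule Suc.IH)
  have root: "poly p a = 0" using Suc.prems[of 0] by simp
  show ?case
  proof (cases "pderiv p = 0")
    case True
    then obtain h where "p = [:h:]" using pderiv_iszero by blast
    with root show ?thesis by simp
  next
    case False
    then have "p \<noteq> 0" by auto
    with IH False root show ?thesis by (simp add: order_divides order_pderiv del: power_Suc)
  qed
qed simp

text \<open>Divisibility uses up the whole degree, leaving a constant cofactor, possibly 0.\<close>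

lemma poly_eq_smult_linear_power:
  fixes p :: "real poly"
  assumes "degree p \<le> k" "\<And>l. l < k \<Longrightarrow> poly ((pderiv ^^ l) p) a = 0"
  obtains b where "p = smult b ([:-a, 1:] ^ k)"
proof -
  obtain q where q: "p = [:-a, 1:] ^ k * q" using power_dvd_if_higher_pderiv_zero[OF assms(2)] by auto
  show ?thesis
  proof (cases "q = 0")
    case True
    then show ?thesis using that[of 0] q by simp
  next
    case False
    then have "degree q = 0" using assms(1) q by (simp add: degree_mult_eq degree_linear_power)
    then obtain b where "q = [:b:]" by (rule degree_eq_zeroE)
    then show ?thesis using that[of b] q by simp
  qed
qed

text \<open>Uniqueness of derivatives identifies \<open>F l\<close> inside the piece, and continuity
  carries the identity to both ends, where neighbouring pieces can be compared.\<close>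

lemma higher_deriv_piece:
  assumes F: "\<forall>i<k. \<forall>x\<in>{c..d}. (F i has_real_derivative F (Suc i) x) (at x within {c..d})"
    "continuous_on {c..d} (F k)"
    and uv: "c \<le> u" "u < v" "v \<le> d" and piece: "\<And>x. u < x \<Longrightarrow> x < v \<Longrightarrow> F 0 x = poly p x"
    and "l \<le> k" and x: "x \<in> {u..v}"
  shows "F l x = poly ((pderiv ^^ l) p) x"
proof -
  have open_eq: "F l x = poly ((pderiv ^^ l) p) x" if "u < x" "x < v" for x
    using that \<open>l \<le> k\<close>
  proof (induction l arbitrary: x)
    case (Suc l)
    have "(F l has_real_derivative F (Suc l) x) (at x within {c..d})" using F(1) uv Suc.prems by auto
    moreover have "at x within {c..d} = at x" by (rule at_within_Icc_at) (use uv Suc.prems in auto)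
    ultimately have "(F l has_real_derivative F (Suc l) x) (at x)" by simp
    from has_field_derivative_transform_within_open[OF this, of "{u<..<v}" "poly ((pderiv ^^ l) p)"]
    have "(poly ((pderiv ^^ l) p) has_real_derivative F (Suc l) x) (at x)" using Suc by simp
    from DERIV_unique[OF this poly_DERIV] show ?case by simp
  qed (simp add: piece)
  have "continuous_on {c..d} (F l)"
  proof (cases "l = k")
    case False
    with F(1) \<open>l \<le> k\<close> show ?thesis by (intro DERIV_continuous_on[where D = "F (Suc l)"]) auto
  qed (use F(2) in simp)
  then have "continuous_on {u..v} (\<lambda>x. F l x - poly ((pderiv ^^ l) p) x)"
    by (intro continuous_intros) (rule continuous_on_subset, use uv in auto)
  then have cont: "continuous_on (closure {u<..<v}) (\<lambda>x. F l x - poly ((pderiv ^^ l) p) x)"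
    using uv(2) by simp
  have "x \<in> closure {u<..<v}" using uv(2) x by simp
  then have "F l x - poly ((pderiv ^^ l) p) x = 0"
  proof (rule continuous_constant_on_closure[OF cont, of 0 x, rotated])
    fix z assume "z \<in> {u<..<v}"
    then show "F l z - poly ((pderiv ^^ l) p) z = 0" using open_eq[of z] by simp
  qed
  then show ?thesis by simp
qed

text \<open>The combination is built from left to right: powers at \<open>c\<close> reproduce the
  first polynomial on all of \<open>[c, d]\<close>, and each knot corrects everything to its right
  by one truncated power.\<close>

lemma spline_in_span_tpow:
  assumes "c < d" "is_partition c d \<Delta>" "m \<ge> 1" and f: "f \<in> spline_space m c d \<Delta>"
  shows "f \<in> span (tpow d ` tpow_index m c d \<Delta>)"
proof -
  define N where "N = num_knots c d \<Delta>"
  let ?T = "tpow d ` tpow_index m c d \<Delta>"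
  note knot_facts = knot_0[OF assms(1,2)] knot_last[OF assms(1,2), folded N_def]
    knot_less[OF assms(1,2), folded N_def] knots_between[OF assms(1,2), folded N_def]
  obtain p where p: "\<And>i. i \<le> N \<Longrightarrow> degree (p i) \<le> m - 1"
    "\<And>i x. i \<le> N \<Longrightarrow> x \<in> subinterval c d \<Delta> i \<Longrightarrow> f x = poly (p i) x"
    using f unfolding spline_space_def N_def[symmetric] mem_Collect_eq by metis
  have jump: "\<exists>b. p (Suc i) = p i + smult b ([:-knot \<Delta> (Suc i), 1:] ^ (m - 1))" if i: "i < N" for i
  proof -
    have "poly ((pderiv ^^ l) (p (Suc i) - p i)) (knot \<Delta> (Suc i)) = 0" if l: "l < m - 1" for l
    proof -
      \<comment> \<open>\<open>l < m - 1\<close> forces \<open>m \<ge> 2\<close>, so the smoothness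
        clause is available; for \<open>m = 1\<close> the claim is vacuous.\<close>
      obtain F where F: "F 0 = f"
        "\<forall>i<m - 2. \<forall>x\<in>{c..d}. (F i has_real_derivative F (Suc i) x) (at x within {c..d})"
        "continuous_on {c..d} (F (m - 2))"
        using f l unfolding spline_space_def Ck_on_def by auto
      \<comment> \<open>The knot is the right end of piece \<open>i\<close> and the left end of
        piece \<open>Suc i\<close>.\<close>
      have "F l (knot \<Delta> (Suc i)) = poly ((pderiv ^^ l) (p j)) (knot \<Delta> (Suc i))"
        if "j = i \<or> j = Suc i" for j
      proof (rule higher_deriv_piece[OF F(2,3), of "knot \<Delta> j" "knot \<Delta> (Suc j)"])
        show "F 0 x = poly (p j) x" if "knot \<Delta> j < x" "x < knot \<Delta> (Suc j)" for x
          using that \<open>j = i \<or> j = Suc i\<close> i p(2)[of j x] by (auto simp: F(1) subinterval_def)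
      qed (use that i l knot_facts(3)[of j "Suc j"] knot_facts(4)[of j] knot_facts(4)[of "Suc j"] in auto)
      from this[of i] this[of "Suc i"] show ?thesis
        using higher_pderiv_add[of l "p i" "p (Suc i) - p i"] by simp
    qed
    moreover have "degree (p (Suc i) - p i) \<le> m - 1" using p(1) i by (intro degree_diff_le) auto
    ultimately obtain b where "p (Suc i) - p i = smult b ([:-knot \<Delta> (Suc i), 1:] ^ (m - 1))"
      using poly_eq_smult_linear_power by blast
    then show ?thesis by (auto simp: algebra_simps)
  qed
  \<comment> \<open>The last clause lets \<open>g\<close> continue the current polynomial up to
    \<open>d\<close>, so that one added truncated power is correct on the next piece.\<close>
  have "\<exists>g\<in>span ?T. (\<forall>j\<le>i. \<forall>x\<in>subinterval c d \<Delta> j. g x = f x) \<and> (\<forall>x\<in>{knot \<Delta> i..d}. g x = poly (p i) x)"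
    if "i \<le> N" for i
    using that
  proof (induction i)
    case 0
    \<comment> \<open>The shift by \<open>c\<close> turns coefficients into those of powers of
      \<open>x - c\<close>.\<close>
    define q where "q = pcompose (p 0) [:c, 1:]"
    define g where "g = (\<Sum>k<m. coeff q k *\<^sub>R tpow d (c, k))"
    have "degree q < m" using p(1)[of 0] assms(3) by (simp add: q_def degree_pcompose)
    have "g x = poly (p 0) x" if "x \<in> {c..d}" for x
    proof -
      have "g x = (\<Sum>k<m. coeff q k * (x - c) ^ k)"
        using that by (simp add: g_def sum_fun_apply scaleR_fun_def tpow_def)
      also have "\<dots> = (\<Sum>k\<le>degree q. coeff q k * (x - c) ^ k)"
        by (rule sum.mono_neutral_right) (use \<open>degree q < m\<close> in \<open>auto simp: coeff_eq_0\<close>)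
      also have "\<dots> = poly (p 0) x" by (simp add: poly_altdef[symmetric] q_def poly_pcompose)
      finally show ?thesis .
    qed
    moreover have "g \<in> span ?T"
      unfolding g_def by (intro span_sum span_scale span_base) (auto simp: tpow_index_def)
    moreover have "subinterval c d \<Delta> 0 \<subseteq> {c..d}"
      using Icc_eq_subintervals[OF assms(1,2)] by blast
    ultimately show ?case using p(2)[of 0] knot_facts(1) by (intro bexI[of _ g]) auto
  next
    case (Suc i)
    let ?a = "knot \<Delta> (Suc i)"
    from Suc obtain g where g: "g \<in> span ?T" "\<And>j x. j \<le> i \<Longrightarrow> x \<in> subinterval c d \<Delta> j \<Longrightarrow> g x = f x"
      "\<And>x. x \<in> {knot \<Delta> i..d} \<Longrightarrow> g x = poly (p i) x" by auto
    from jump[of i] Suc.prems obtain b where b: "p (Suc i) = p i + smult b ([:-?a, 1:] ^ (m - 1))" by auto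
    define h where "h = g + b *\<^sub>R tpow d (?a, m - 1)"
    have "(?a, m - 1) \<in> tpow_index m c d \<Delta>"
      using Suc.prems by (auto simp: tpow_index_def interior_knots_eq[OF assms(1,2)] N_def)
    then have "h \<in> span ?T" unfolding h_def by (intro span_add span_scale g(1) span_base imageI)
    moreover have right: "h x = poly (p (Suc i)) x" if "x \<in> {?a..d}" for x
      using that g(3)[of x] knot_facts(3)[of i "Suc i"] Suc.prems
      by (simp add: h_def b scaleR_fun_def tpow_def)
    moreover have "h x = f x" if "j \<le> Suc i" "x \<in> subinterval c d \<Delta> j" for j x
    proof (cases "j = Suc i")
      case True
      have "x \<in> {?a..d}" using that True Suc.prems knot_facts(4)[of "Suc j"]
        by (auto simp: subinterval_def N_def[symmetric] split: if_splits)
      then show ?thesis using right p(2)[of "Suc i" x] Suc.prems that True by simp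
    next
      case False
      then have "j \<le> i" using that by simp
      then have "knot \<Delta> (Suc j) \<le> ?a" using knot_facts(3)[of "Suc j" "Suc i"] Suc.prems
        by (cases "j = i") auto
      then have "x < ?a" using that \<open>j \<le> i\<close> Suc.prems
        by (auto simp: subinterval_def N_def[symmetric])
      then show ?thesis using g(2)[OF \<open>j \<le> i\<close>] that by (simp add: h_def scaleR_fun_def tpow_def)
    qed
    ultimately show ?case by (intro bexI[of _ h]) auto
  qed
  from this[of N] obtain g where g: "g \<in> span ?T" "\<And>x. x \<in> {c..d} \<Longrightarrow> g x = f x"
    using Icc_eq_subintervals[OF assms(1,2)] by (auto simp: N_def[symmetric])
  have "span ?T \<subseteq> spline_space m c d \<Delta>"
    by (rule span_minimal[OF _ subspace_spline_space]) (use tpow_in_spline_space[OF assms(1-3)] in auto)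
  then have "g x = 0" if "x \<notin> {c..d}" for x using g(1) that by (auto simp: spline_space_def)
  moreover have "f x = 0" if "x \<notin> {c..d}" for x using f that by (auto simp: spline_space_def)
  ultimately have "g = f" using g(2) by (metis ext)
  with g(1) show ?thesis by simp
qed

lemma span_tpow:
  assumes "c < d" "is_partition c d \<Delta>" "m \<ge> 1"
  shows "span (tpow d ` tpow_index m c d \<Delta>) = spline_space m c d \<Delta>"
proof (rule subset_antisym)
  show "span (tpow d ` tpow_index m c d \<Delta>) \<subseteq> spline_space m c d \<Delta>"
    by (rule span_minimal[OF image_subsetI subspace_spline_space]) (rule tpow_in_spline_space[OF assms])
  show "spline_space m c d \<Delta> \<subseteq> span (tpow d ` tpow_index m c d \<Delta>)"
    by (rule subsetI) (rule spline_in_span_tpow[OF assms])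
qed

section \<open>B-splines\<close>

text \<open>Monotone knots nest the supports of both lower-order terms between \<open>y j\<close>
  and \<open>y (j + r)\<close>.\<close>

lemma bspline_eq_0:
  assumes "mono_on {j..j + r} y" "x < y j \<or> y (j + r) \<le> x"
  shows "bspline y r j x = 0"
  using assms
proof (induction y r j x rule: bspline.induct)
  case (3 y r j x)
  have "y j \<le> y (j + 1)" "y (j + Suc r) \<le> y (j + Suc (Suc r))"
    using 3(3) by (auto intro: mono_onD)
  moreover have "mono_on {j..j + Suc r} y" "mono_on {j + 1..j + 1 + Suc r} y"
    using 3(3) by (auto intro: mono_on_subset)
  ultimately have "bspline y (Suc r) j x = 0" "bspline y (Suc r) (j + 1) x = 0"
    using 3(4) by (intro 3(1,2); force)+
  then show ?case by simp
qed auto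

text \<open>\<open>Lim\<close> is meaningful only where a limit exists, so the value of
  \<open>bspline_on\<close> at \<open>d\<close> relies on this. Order one is eventually constant,
  and the recursion coefficients are continuous.\<close>

lemma bspline_left_limit: "\<exists>L. (bspline y r j \<longlongrightarrow> L) (at_left d)"
proof (induction r arbitrary: j rule: induct_nat_012)
  case 0
  show ?case by (auto intro!: exI[of _ 0])
next
  case 1
  have "eventually (\<lambda>x. y j \<le> x \<longleftrightarrow> y j < d) (at_left d)"
    unfolding eventually_at_left_field by (cases "y j < d") (auto intro: exI[of _ "y j"] exI[of _ "d - 1"])
  moreover have "eventually (\<lambda>x. x < y (j + 1) \<longleftrightarrow> d \<le> y (j + 1)) (at_left d)"
    unfolding eventually_at_left_field by (cases "y (j + 1) < d") (auto intro: exI[of _ "y (j + 1)"] exI[of _ "d - 1"])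
  ultimately have "eventually (\<lambda>x. bspline y (Suc 0) j x = (if y j < d \<and> d \<le> y (j + 1) then 1 else 0)) (at_left d)"
    by eventually_elim simp
  then show ?case using tendsto_eventually by blast
next
  case (ge2 r)
  obtain L M where LM: "(bspline y (Suc r) j \<longlongrightarrow> L) (at_left d)" "(bspline y (Suc r) (j + 1) \<longlongrightarrow> M) (at_left d)"
    using ge2 by meson
  define p q where "p x = (x - y j) / (y (j + Suc r) - y j)"
    and "q x = (y (j + Suc (Suc r)) - x) / (y (j + Suc (Suc r)) - y (j + 1))" for x
  have "(p \<longlongrightarrow> p d) (at_left d)" "(q \<longlongrightarrow> q d) (at_left d)"
    \<comment> \<open>As products with a constant inverse, the coefficients converge even if a
      denominator vanishes.\<close>
    unfolding p_def q_def divide_inverse by (intro tendsto_intros)+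
  then have "((\<lambda>x. p x * bspline y (Suc r) j x + q x * bspline y (Suc r) (j + 1) x) \<longlongrightarrow> p d * L + q d * M) (at_left d)"
    by (intro tendsto_intros LM)
  then show ?case unfolding p_def q_def bspline.simps(3)[symmetric] by blast
qed

text \<open>An identity on \<open>[c, d)\<close> suffices: left limits extend it to
  \<open>d\<close>, and both sides vanish outside \<open>[c, d]\<close>.\<close>

lemma tpow_eq_sum_bsplines:
  assumes "c \<le> a" "a < d"
    and "\<And>x. c \<le> x \<Longrightarrow> x < d \<Longrightarrow> tpow d (a, k) x = (\<Sum>j\<in>J. w j * bspline y m j x)"
  shows "tpow d (a, k) = (\<Sum>j\<in>J. w j *\<^sub>R bspline_on c d y m j)"
proof
  fix x
  have "(\<Sum>j\<in>J. w j *\<^sub>R bspline_on c d y m j) x = (\<Sum>j\<in>J. w j * bspline_on c d y m j x)"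
    by (simp add: sum_fun_apply scaleR_fun_def)
  moreover have "tpow d (a, k) x = (\<Sum>j\<in>J. w j * bspline_on c d y m j x)"
  proof (cases "x = d")
    case True
    have "eventually (\<lambda>x. (x - a) ^ k = (\<Sum>j\<in>J. w j * bspline y m j x)) (at_left d)"
      unfolding eventually_at_left_field using assms
      by (intro exI[of _ a]) (auto simp: assms(3)[symmetric] tpow_def)
    moreover have "((\<lambda>x. (x - a) ^ k) \<longlongrightarrow> (d - a) ^ k) (at_left d)" by (intro tendsto_intros)
    ultimately have "((\<lambda>x. \<Sum>j\<in>J. w j * bspline y m j x) \<longlongrightarrow> (d - a) ^ k) (at_left d)"
      by (rule Lim_transform_eventually[rotated])
    moreover have "(bspline y m j \<longlongrightarrow> Lim (at_left d) (bspline y m j)) (at_left d)" for j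
      using bspline_left_limit[of y m j d] tendsto_Lim[OF trivial_limit_at_left_real] by metis
    then have "((\<lambda>x. \<Sum>j\<in>J. w j * bspline y m j x) \<longlongrightarrow>
        (\<Sum>j\<in>J. w j * Lim (at_left d) (bspline y m j))) (at_left d)" by (intro tendsto_intros)
    ultimately have "(d - a) ^ k = (\<Sum>j\<in>J. w j * Lim (at_left d) (bspline y m j))"
      by (rule tendsto_unique[OF trivial_limit_at_left_real])
    then show ?thesis using True assms(1,2) by (simp add: tpow_def bspline_on_def)
  next
    case False
    then show ?thesis using assms by (cases "c \<le> x \<and> x < d") (auto simp: bspline_on_def tpow_def)
  qed
  ultimately show "tpow d (a, k) x = (\<Sum>j\<in>J. w j *\<^sub>R bspline_on c d y m j) x" by simp
qed

section \<open>Marsden's identity\<close>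

text \<open>Strict growth is demanded only from \<open>y m\<close> to
  \<open>y (Suc (m + N))\<close>, a range that covers the interval; the outer knots may
  coincide.\<close>

locale knot_sequence =
  fixes y :: "nat \<Rightarrow> real" and c d :: real and m N :: nat
  assumes order_pos: "m \<ge> 1"
    and mono_knots: "mono_on {1..2 * m + N} y"
    and strict_knots: "m \<le> i \<Longrightarrow> i \<le> m + N \<Longrightarrow> y i < y (Suc i)"
    and left_knot: "y m \<le> c" and right_knot: "d \<le> y (Suc (m + N))"
begin

text \<open>The dual polynomials are written in the shifted variable \<open>\<tau> - c\<close>, so that comparing
  coefficients yields the powers of \<open>x - c\<close> and evaluating at \<open>y i - c\<close> the truncated powers.\<close>

definition marsden_poly :: "nat \<Rightarrow> nat \<Rightarrow> real poly" where
  "marsden_poly r j = (\<Prod>i\<in>{1..<r}. [:y (j + i) - c, -1:])"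

text \<open>The two dual polynomials share all factors but one. The weights are the affine
  coordinates of \<open>x\<close> relative to two knots, so the differing linear factors combine to
  the one belonging to \<open>x\<close>.\<close>

lemma marsden_poly_recurrence:
  assumes "r \<ge> 1" "y (Suc j) \<noteq> y (Suc j + r)"
  shows "smult ((x - y (Suc j)) / (y (Suc j + r) - y (Suc j))) (marsden_poly (Suc r) (Suc j)) +
      smult ((y (Suc j + r) - x) / (y (Suc j + r) - y (Suc j))) (marsden_poly (Suc r) j) =
    [:x - c, -1:] * marsden_poly r (Suc j)"
proof -
  define a b where "a = y (Suc j)" and "b = y (Suc j + r)"
  define w v where "w = (x - a) / (b - a)" and "v = (b - x) / (b - a)"
  have "a \<noteq> b" using assms(2) by (simp add: a_def b_def)
  then have wv: "w + v = 1" "w * b + v * a = x"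
    by (simp_all add: w_def v_def divide_simps) (simp_all add: algebra_simps)
  have up: "marsden_poly (Suc r) (Suc j) = marsden_poly r (Suc j) * [:b - c, -1:]"
    using assms(1) by (simp add: marsden_poly_def b_def)
  have "{1..<Suc r} = insert 1 {Suc 1..<Suc r}" using assms(1) by auto
  then have low: "marsden_poly (Suc r) j = [:a - c, -1:] * marsden_poly r (Suc j)"
    by (simp add: marsden_poly_def a_def prod.shift_bounds_Suc_ivl del: prod.op_ivl_Suc)
  have "smult w (marsden_poly (Suc r) (Suc j)) + smult v (marsden_poly (Suc r) j) =
      (smult w [:b - c, -1:] + smult v [:a - c, -1:]) * marsden_poly r (Suc j)"
    by (simp only: up low ring_distribs mult_smult_left mult_smult_right mult.commute)
  also have "smult w [:b - c, -1:] + smult v [:a - c, -1:] = [:(w * b + v * a) - (w + v) * c, -(w + v):]"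
    by (simp add: algebra_simps)
  finally have "smult w (marsden_poly (Suc r) (Suc j)) + smult v (marsden_poly (Suc r) j) =
      [:x - c, -1:] * marsden_poly r (Suc j)" by (simp only: wv mult_1)
  then show ?thesis by (simp only: w_def v_def a_def b_def)
qed

text \<open>Order one gives indicators of consecutive half-open intervals, which join up.\<close>

lemma sum_bspline_order_1:
  assumes "y m \<le> x" "k \<le> N"
  shows "(\<Sum>j=m..m + k. bspline y (Suc 0) j x) = (if x < y (Suc (m + k)) then 1 else 0)"
  using assms(2)
proof (induction k)
  case (Suc k)
  then show ?case using strict_knots[of "m + Suc k"] by (auto split: if_splits)
qed (use assms(1) in simp)

text \<open>Between \<open>i\<close> and \<open>j\<close> lies a step in the range of strict growth,
  namely the one after \<open>max i m\<close>. This keeps the denominators of the recursion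
  nonzero.\<close>

lemma knots_separated:
  assumes "1 \<le> i" "i \<le> m + N" "m < j" "i < j" "j \<le> 2 * m + N"
  shows "y i < y j"
proof -
  define l where "l = max i m"
  have "y i \<le> y l" "y (Suc l) \<le> y j"
    using assms by (auto simp: l_def intro!: mono_onD[OF mono_knots])
  moreover have "y l < y (Suc l)" using assms by (intro strict_knots) (auto simp: l_def)
  ultimately show ?thesis by simp
qed

text \<open>Each order contributes one factor, by \<open>marsden_poly_recurrence\<close>. The lower
  limit moves left with \<open>r\<close> because a support of order \<open>r\<close> reaches past
  \<open>y m\<close> only from index \<open>Suc m - r\<close> on.\<close>

lemma marsden_identity:
  assumes x: "y m \<le> x" "x < y (Suc (m + N))" and "1 \<le> r" "r \<le> m"
  shows "(\<Sum>j=Suc m - r..m + N. smult (bspline y r j x) (marsden_poly r j)) = [:x - c, -1:] ^ (r - 1)"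
  using assms(3,4)
proof (induction r rule: dec_induct)
  case base
  have "(\<Sum>j=m..m + N. smult (bspline y (Suc 0) j x) 1) = smult (\<Sum>j=m..m + N. bspline y (Suc 0) j x) 1"
    by (rule smult_sum[symmetric])
  then show ?case using sum_bspline_order_1[OF x(1), of N] x(2) by (simp add: marsden_poly_def)
next
  case (step r)
  define lo where "lo = m - r"
  define w v where "w j = (x - y j) / (y (j + r) - y j)" and "v j = (y (j + r) - x) / (y (j + r) - y j)" for j
  let ?B = "\<lambda>j. bspline y r j x" and ?Q = "marsden_poly (Suc r)"
  have lo: "1 \<le> lo" "lo + r = m" "lo \<le> m + N" and lo_eq: "Suc m - r = Suc lo"
    using step by (auto simp: lo_def)
  have rec: "bspline y (Suc r) j x = w j * ?B j + v (Suc j) * ?B (Suc j)" for j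
    using step.hyps by (cases r) (auto simp: w_def v_def)
  \<comment> \<open>Boundary terms drop out: one support ends at \<open>y m\<close>, the other
    starts at \<open>y (Suc (m + N))\<close>.\<close>
  have "?B lo = 0"
    using lo x by (intro bspline_eq_0 mono_on_subset[OF mono_knots]) auto
  moreover have "?B (Suc (m + N)) = 0"
    using step x by (intro bspline_eq_0 mono_on_subset[OF mono_knots]) auto
  moreover have "(\<Sum>j=lo..m + N. smult (bspline y (Suc r) j x) (?Q j)) =
      (\<Sum>j=lo..m + N. smult (w j * ?B j) (?Q j)) + (\<Sum>j=lo..m + N. smult (v (Suc j) * ?B (Suc j)) (?Q j))"
    by (simp add: rec smult_add_left sum.distrib)
  \<comment> \<open>The index shift collects both contributions of the same B-spline of order
    \<open>r\<close>.\<close>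
  moreover have "(\<Sum>j=lo..m + N. smult (v (Suc j) * ?B (Suc j)) (?Q j)) =
      (\<Sum>j=Suc lo..Suc (m + N). smult (v j * ?B j) (?Q (j - 1)))"
    by (simp only: sum.shift_bounds_cl_Suc_ivl diff_Suc_1)
  ultimately have "(\<Sum>j=lo..m + N. smult (bspline y (Suc r) j x) (?Q j)) =
      (\<Sum>j=Suc lo..m + N. smult (w j * ?B j) (?Q j)) + (\<Sum>j=Suc lo..m + N. smult (v j * ?B j) (?Q (j - 1)))"
    using lo by (simp add: sum.atLeast_Suc_atMost)
  also have "\<dots> = (\<Sum>j=Suc lo..m + N. smult (?B j) (smult (w j) (?Q j) + smult (v j) (?Q (j - 1))))"
    by (simp add: sum.distrib[symmetric] smult_add_right mult.commute)
  also have "\<dots> = (\<Sum>j=Suc lo..m + N. smult (?B j) ([:x - c, -1:] * marsden_poly r j))"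
  proof (intro sum.cong refl)
    fix j assume j: "j \<in> {Suc lo..m + N}"
    then obtain i where i: "j = Suc i" by (cases j) auto
    \<comment> \<open>The first index \<open>Suc lo\<close> gives \<open>j + r > m\<close>, as
      separation requires.\<close>
    have "y j < y (j + r)" using j lo step by (intro knots_separated) auto
    then show "smult (?B j) (smult (w j) (?Q j) + smult (v j) (?Q (j - 1))) =
        smult (?B j) ([:x - c, -1:] * marsden_poly r j)"
      unfolding i w_def v_def diff_Suc_1 using step.hyps(1) by (subst marsden_poly_recurrence) auto
  qed
  also have "\<dots> = [:x - c, -1:] * (\<Sum>j=Suc m - r..m + N. smult (?B j) (marsden_poly r j))"
    unfolding lo_eq by (simp only: sum_distrib_left mult_smult_right)
  also have "\<dots> = [:x - c, -1:] ^ (Suc r - 1)"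
    using step by (simp add: power_eq_if)
  finally show ?case by (simp only: lo_def diff_Suc_Suc)
qed

lemma marsden_full:
  assumes "c \<le> x" "x < d"
  shows "(\<Sum>j=1..m + N. smult (bspline y m j x) (marsden_poly m j)) = [:x - c, -1:] ^ (m - 1)"
  using marsden_identity[of x m] assms order_pos left_knot right_knot by simp

text \<open>This compares coefficients of degree \<open>m - 1 - k\<close> in Marsden's identity and
  divides by the nonzero constant that multiplies \<open>(x - c) ^ k\<close>.\<close>

lemma power_eq_sum_bsplines:
  assumes "c \<le> x" "x < d" "k < m"
  shows "(x - c) ^ k = (\<Sum>j=1..m + N. coeff (marsden_poly m j) (m - 1 - k) /
      (of_nat ((m - 1) choose (m - 1 - k)) * (-1) ^ (m - 1 - k)) * bspline y m j x)"
proof -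
  define l where "l = m - 1 - k"
  have "(\<Sum>j=1..m + N. bspline y m j x * coeff (marsden_poly m j) l) = coeff ([:x - c, -1:] ^ (m - 1)) l"
    unfolding marsden_full[OF assms(1,2), symmetric] by (simp add: coeff_sum)
  also have "\<dots> = of_nat ((m - 1) choose l) * (-1) ^ l * (x - c) ^ k"
    using assms(3) by (subst coeff_linear_poly_power) (auto simp: l_def)
  finally have "(x - c) ^ k = (\<Sum>j=1..m + N. bspline y m j x * coeff (marsden_poly m j) l) /
      (of_nat ((m - 1) choose l) * (-1) ^ l)"
    by (simp add: l_def)
  then show ?thesis unfolding l_def[symmetric] by (simp add: sum_divide_distrib mult.commute)
qed

text \<open>Specialising Marsden's identity at the knot \<open>y i\<close> kills the B-splines whose support straddles it,
  so those supported to its right reproduce the truncated power.\<close>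

lemma truncated_power_eq_sum_bsplines:
  assumes "c \<le> x" "x < d" "m < i" "i \<le> m + N"
  shows "(if y i \<le> x then (x - y i) ^ (m - 1) else 0) =
    (\<Sum>j=i..m + N. poly (marsden_poly m j) (y i - c) * bspline y m j x)"
proof (cases "y i \<le> x")
  case True
  have "(\<Sum>j=i..m + N. poly (marsden_poly m j) (y i - c) * bspline y m j x) =
      (\<Sum>j=1..m + N. poly (marsden_poly m j) (y i - c) * bspline y m j x)"
  proof (intro sum.mono_neutral_left ballI)
    fix j assume "j \<in> {1..m + N} - {i..m + N}"
    then have j: "1 \<le> j" "j < i" by auto
    show "poly (marsden_poly m j) (y i - c) * bspline y m j x = 0"
    \<comment> \<open>Either the support of the B-spline ends by \<open>y i\<close>, or
      \<open>y i\<close> is one of its inner knots and hence a root of the dual polynomial.\<close>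
    proof (cases "j + m \<le> i")
      case True
      then have "y (j + m) \<le> y i" using j assms(4) by (intro mono_onD[OF mono_knots]) auto
      then have "bspline y m j x = 0" using \<open>y i \<le> x\<close> j True assms(4)
        by (intro bspline_eq_0 mono_on_subset[OF mono_knots]) auto
      then show ?thesis by simp
    next
      case False
      then have "i - j \<in> {1..<m}" "y (j + (i - j)) = y i" using j by auto
      then have "poly (marsden_poly m j) (y i - c) = 0"
        unfolding marsden_poly_def poly_prod by (intro prod_zero) auto
      then show ?thesis by simp
    qed
  qed (use assms in auto)
  also have "\<dots> = poly ([:x - c, -1:] ^ (m - 1)) (y i - c)"
    unfolding marsden_full[OF assms(1,2), symmetric] by (simp add: poly_sum mult.commute)
  finally show ?thesis using True by simp
next
  case False
  have "bspline y m j x = 0" if "j \<in> {i..m + N}" for j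
  proof (intro bspline_eq_0 mono_on_subset[OF mono_knots])
    have "y i \<le> y j" using that assms by (intro mono_onD[OF mono_knots]) auto
    then show "x < y j \<or> y (j + m) \<le> x" using False by simp
  qed (use that assms in auto)
  then show ?thesis using False by simp
qed

end

text \<open>The central knots are the interior knots, flanked by \<open>y m \<le> c\<close> and a
  knot beyond \<open>d\<close>; strict growth at both ends follows because interior knots lie
  strictly between \<open>c\<close> and \<open>d\<close>.\<close>

lemma extended_partition_knot_sequence:
  assumes "c < d" "is_partition c d \<Delta>" "m \<ge> 1" "extended_partition m c d \<Delta> y"
  shows "knot_sequence y c d m (num_knots c d \<Delta>)"
proof -
  define N where "N = num_knots c d \<Delta>"
  have "N \<ge> 1" using assms(2) by (simp add: is_partition_def N_def)
  have y: "\<And>i. 1 \<le> i \<Longrightarrow> i \<le> N \<Longrightarrow> y (m + i) = knot \<Delta> i"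
    "\<And>i. 1 \<le> i \<Longrightarrow> i < m \<Longrightarrow> y i \<le> y (Suc i)" "y m \<le> c" "d \<le> y (Suc (m + N))"
    "\<And>i. m + N + 1 \<le> i \<Longrightarrow> i < 2 * m + N \<Longrightarrow> y i \<le> y (Suc i)"
    using assms(4) by (auto simp: extended_partition_def N_def[symmetric] Let_def)
  have inner: "c < knot \<Delta> i" "knot \<Delta> i < d" if "1 \<le> i" "i \<le> N" for i
    using knot_less[OF assms(1,2), of 0 i] knot_less[OF assms(1,2), of i "Suc N"] that
      knot_0[OF assms(1,2)] knot_last[OF assms(1,2)] by (auto simp: N_def)
  have strict: "y i < y (Suc i)" if "m \<le> i" "i \<le> m + N" for i
  proof -
    define k where "k = i - m"
    then have k: "i = m + k" "k \<le> N" using that by auto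
    have "y (m + k) \<le> c \<and> k = 0 \<or> y (m + k) = knot \<Delta> k \<and> 1 \<le> k" using y(1)[of k] y(3) k by (cases k) auto
    moreover have "y (m + Suc k) = knot \<Delta> (Suc k) \<and> k < N \<or> d \<le> y (m + Suc k) \<and> k = N"
      using y(1)[of "Suc k"] y(4) k by (cases "k = N") auto
    ultimately show ?thesis
      using inner[of k] inner[of "Suc k"] knot_less[OF assms(1,2), of k "Suc k"] k \<open>N \<ge> 1\<close>
      by (auto simp: N_def[symmetric])
  qed
  have knots_le: "y i \<le> y (Suc i)" if "1 \<le> i" "i < 2 * m + N" for i
    using that y(2)[of i] y(5)[of i] strict[of i] by linarith
  have "mono_on {1..2 * m + N} y"
  proof (rule mono_onI)
    fix i j assume "i \<in> {1..2 * m + N}" "j \<in> {1..2 * m + N}" "i \<le> j"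
    from this(3,1,2) show "y i \<le> y j"
    proof (induction j rule: dec_induct)
      case (step k)
      then show ?case using knots_le[of k] by simp
    qed simp
  qed
  with y(3,4) strict assms(3) show ?thesis
    unfolding N_def[symmetric] by unfold_locales
qed

section \<open>The B-spline basis\<close>

text \<open>Steinitz exchange: an element of \<open>B\<close> outside \<open>span T\<close> would
  enlarge the independent set beyond \<open>card B\<close>, and a redundant one would leave too few
  generators.\<close>

lemma spanning_set_of_independent_card:
  assumes "finite B" "independent T" "T \<subseteq> span B" "card B \<le> card T"
  shows "independent B" "span B = span T" "card B = card T"
proof -
  have bound: "card T' \<le> card B'" if "independent T'" "T' \<subseteq> span B'" "finite B'" for T' B'
    using independent_span_bound[OF that(3,1,2)] by simp
  from bound[OF assms(2,3,1)] assms(4) show eq: "card B = card T" by simp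
  have "finite T" using independent_span_bound[OF assms(1-3)] by simp
  have "b \<in> span T" if "b \<in> B" for b
  proof (rule ccontr)
    assume b: "b \<notin> span T"
    then have "b \<notin> T" using span_base by blast
    with b have "card (insert b T) \<le> card B"
      using assms(1-3) that span_base by (intro bound) (auto simp: independent_insert)
    then show False using eq \<open>b \<notin> T\<close> \<open>finite T\<close> by simp
  qed
  then show "span B = span T" using assms(3) by (auto simp: span_eq)
  show "independent B"
  proof
    assume "dependent B"
    then obtain b where b: "b \<in> B" "b \<in> span (B - {b})" unfolding dependent_def by blast
    have "card T \<le> card (B - {b})"
      using assms(1-3) b span_redundant[OF b(2)] by (intro bound) (auto simp: insert_absorb)
    moreover have "card (B - {b}) < card B" using assms(1) b(1) by (rule card_Diff1_less)
    ultimately show False using eq by simp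
  qed
qed

lemma bsplines_basis:
  assumes "c < d" "is_partition c d \<Delta>" "m \<ge> 1" "extended_partition m c d \<Delta> y"
  shows "span (bspline_set m c d \<Delta> y) = spline_space m c d \<Delta>"
    and "independent (bspline_set m c d \<Delta> y)"
    and "inj_on (bspline_on c d y m) {1..m + num_knots c d \<Delta>}"
proof -
  define N where "N = num_knots c d \<Delta>"
  define I where "I = tpow_index m c d \<Delta>"
  interpret knot_sequence y c d m N
    unfolding N_def by (rule extended_partition_knot_sequence[OF assms])
  have fin: "finite (interior_knots c d \<Delta>)"
    using assms(2) by (simp add: is_partition_def interior_knots_def)
  have B: "bspline_set m c d \<Delta> y = bspline_on c d y m ` {1..m + N}"
    by (auto simp: bspline_set_def N_def)
  have "finite I" using fin by (simp add: I_def tpow_index_def)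
  moreover have I_less: "c \<le> a \<and> a < d" if "(a, k) \<in> I" for a k
    using that assms(1,2) by (auto simp: I_def tpow_index_def interior_knots_def is_partition_def less_le)
  ultimately have T: "independent (tpow d ` I)" "inj_on (tpow d) I"
    using independent_tpow[of I d] by blast+
  have "card I = card ({c} \<times> {..<m}) + card (interior_knots c d \<Delta> \<times> {m - 1})"
    unfolding I_def tpow_index_def
    by (rule card_Un_disjoint) (use fin in \<open>auto simp: interior_knots_def\<close>)
  then have card_T: "card (tpow d ` I) = m + N"
    using card_image[OF T(2)] by (simp add: N_def num_knots_def card_cartesian_product)
  \<comment> \<open>Identities are needed only on \<open>[c, d)\<close> and may use a subset
    \<open>J\<close> of the B-splines: all of them for powers, a tail for truncated powers.\<close>
  have combination: "tpow d (a, k) \<in> span (bspline_set m c d \<Delta> y)"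
    if "(a, k) \<in> I" "J \<subseteq> {1..m + N}"
      "\<And>x. c \<le> x \<Longrightarrow> x < d \<Longrightarrow> tpow d (a, k) x = (\<Sum>j\<in>J. w j * bspline y m j x)" for a k J w
  proof -
    have "tpow d (a, k) = (\<Sum>j\<in>J. w j *\<^sub>R bspline_on c d y m j)"
      using that I_less by (intro tpow_eq_sum_bsplines) auto
    also have "\<dots> \<in> span (bspline_set m c d \<Delta> y)"
      unfolding B using that(2) by (intro span_sum span_scale span_base) auto
    finally show ?thesis .
  qed
  have sub: "tpow d ` I \<subseteq> span (bspline_set m c d \<Delta> y)"
  proof (intro image_subsetI)
    fix p assume "p \<in> I"
    then consider k where "p = (c, k)" "k < m" | i where "p = (knot \<Delta> i, m - 1)" "1 \<le> i" "i \<le> N"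
      by (auto simp: I_def tpow_index_def interior_knots_eq[OF assms(1,2)] N_def)
    then show "tpow d p \<in> span (bspline_set m c d \<Delta> y)"
    proof cases
      case 1
      show ?thesis unfolding 1(1)
        by (rule combination[OF _ order_refl], use \<open>p \<in> I\<close> 1 in simp)
          (subst power_eq_sum_bsplines[symmetric], use 1 in \<open>auto simp: tpow_def\<close>)
    next
      case 2
      have "y (m + i) = knot \<Delta> i"
        using assms(4) 2 by (simp add: extended_partition_def Let_def N_def)
      then have "tpow d p x = (\<Sum>j=m + i..m + N. poly (marsden_poly m j) (y (m + i) - c) * bspline y m j x)"
        if "c \<le> x" "x < d" for x
        using that 2 by (subst truncated_power_eq_sum_bsplines[symmetric]) (auto simp: tpow_def)
      then show ?thesis unfolding 2(1)
        by (intro combination) (use \<open>p \<in> I\<close> 2 in auto)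
    qed
  qed
  have finB: "finite (bspline_set m c d \<Delta> y)" by (simp add: B)
  have "card (bspline_set m c d \<Delta> y) \<le> card (tpow d ` I)"
    unfolding card_T B using card_image_le[of "{1..m + N}" "bspline_on c d y m"] by simp
  note main = spanning_set_of_independent_card[OF finB T(1) sub this]
  show "independent (bspline_set m c d \<Delta> y)" by (rule main(1))
  show "span (bspline_set m c d \<Delta> y) = spline_space m c d \<Delta>"
    using main(2) span_tpow[OF assms(1-3)] by (simp add: I_def)
  show "inj_on (bspline_on c d y m) {1..m + num_knots c d \<Delta>}"
    \<comment> \<open>The image has as many elements as its index set, so no two B-splines
      coincide.\<close>
    using main(3) card_T unfolding B by (intro eq_card_imp_inj_on) (auto simp: N_def)
qed

section \<open>Unions of partitions and the dictionary\<close>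

lemma is_partition_Union:
  assumes "finite J" "J \<noteq> {}" "\<And>j. j \<in> J \<Longrightarrow> is_partition c d (P j)"
  shows "is_partition c d (\<Union>j\<in>J. P j)"
proof -
  have fin: "finite (\<Union>j\<in>J. P j)" using assms by (auto simp: is_partition_def)
  obtain j where "j \<in> J" using assms(2) by blast
  then have "num_knots c d (P j) \<le> num_knots c d (\<Union>j\<in>J. P j)"
    unfolding num_knots_def interior_knots_def using fin by (intro card_mono) auto
  then have "1 \<le> num_knots c d (\<Union>j\<in>J. P j)"
    using assms(3)[OF \<open>j \<in> J\<close>] by (simp add: is_partition_def)
  moreover have "(\<Union>j\<in>J. P j) \<subseteq> {c..d}" using assms(3) unfolding is_partition_def by blast
  moreover have "c \<in> (\<Union>j\<in>J. P j)" "d \<in> (\<Union>j\<in>J. P j)"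
    using assms(3) \<open>j \<in> J\<close> unfolding is_partition_def by blast+
  ultimately show ?thesis using fin unfolding is_partition_def by blast
qed

theorem theorem3:
  fixes c d :: real and m n :: nat
    and P :: "nat \<Rightarrow> real set" and Y :: "nat \<Rightarrow> nat \<Rightarrow> real" and \<Delta> :: "real set"
  assumes "c < d" and "m \<ge> 1" and "n \<ge> 1"
    and "\<forall>j\<in>{1..n}. is_partition c d (P j)"
    and "\<forall>j\<in>{1..n}. extended_partition m c d (P j) (Y j)"
    and "\<Delta> = (\<Union>j\<in>{1..n}. P j)"
  shows "span (spline_dictionary m c d n P Y) = spline_space m c d \<Delta> \<and>
    (n = 1 \<longrightarrow>
       spline_dictionary m c d n P Y = bspline_set m c d \<Delta> (Y 1) \<and>
       inj_on (bspline_on c d (Y 1) m) {1..m + num_knots c d \<Delta>} \<and>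
       independent (bspline_set m c d \<Delta> (Y 1)) \<and>
       span (bspline_set m c d \<Delta> (Y 1)) = spline_space m c d \<Delta>)"
proof (intro conjI impI)
  let ?T = "\<lambda>\<Delta>. tpow d ` tpow_index m c d \<Delta>"
  have part: "is_partition c d \<Delta>"
    unfolding assms(6) using assms(3,4) by (intro is_partition_Union) auto
  have span_j: "span (bspline_set m c d (P j) (Y j)) = span (?T (P j))" if "j \<in> {1..n}" for j
    using bsplines_basis(1) span_tpow assms that by simp
  \<comment> \<open>\<open>n \<ge> 1\<close> makes the union nonempty, so the powers at
    \<open>c\<close> occur on the right.\<close>
  have "?T \<Delta> = (\<Union>j\<in>{1..n}. ?T (P j))"
    using assms(3) by (auto simp: assms(6) tpow_index_def interior_knots_def)
  moreover have "bspline_set m c d (P j) (Y j) \<subseteq> span (\<Union>j\<in>{1..n}. ?T (P j))" if "j \<in> {1..n}" for j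
  proof -
    have "span (?T (P j)) \<subseteq> span (\<Union>j\<in>{1..n}. ?T (P j))" using that by (intro span_mono) blast
    then show ?thesis using span_j[OF that] span_superset by blast
  qed
  moreover have "?T (P j) \<subseteq> span (spline_dictionary m c d n P Y)" if "j \<in> {1..n}" for j
  proof -
    have "span (bspline_set m c d (P j) (Y j)) \<subseteq> span (spline_dictionary m c d n P Y)"
      unfolding spline_dictionary_def using that by (intro span_mono) blast
    then show ?thesis using span_j[OF that] span_superset by blast
  qed
  \<comment> \<open>Equality of spans reduces to inclusion of each generating set in the other span,
    checked partition by partition.\<close>
  ultimately have "span (spline_dictionary m c d n P Y) = span (?T \<Delta>)"
    unfolding span_eq by (simp only: spline_dictionary_def UN_subset_iff) blast
  then show "span (spline_dictionary m c d n P Y) = spline_space m c d \<Delta>"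
    using span_tpow[OF assms(1) part assms(2)] by simp
  assume "n = 1"
  then have \<Delta>: "\<Delta> = P 1" and ext: "extended_partition m c d \<Delta> (Y 1)" using assms by auto
  show "spline_dictionary m c d n P Y = bspline_set m c d \<Delta> (Y 1)"
    using \<open>n = 1\<close> \<Delta> by (simp add: spline_dictionary_def)
  note basis = bsplines_basis[OF assms(1) part assms(2) ext]
  show "inj_on (bspline_on c d (Y 1) m) {1..m + num_knots c d \<Delta>}" by (rule basis(3))
  show "independent (bspline_set m c d \<Delta> (Y 1))" by (rule basis(2))
  show "span (bspline_set m c d \<Delta> (Y 1)) = spline_space m c d \<Delta>" by (rule basis(1))
qed

end
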